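(* Let $h:\mathbb{N}\to\mathbb{C}$ be a multiplicative function. Then for any non-prime integer $n\ge 1$, $$\sum_{A\subseteq L_n\setminus\{1,n\}}(-1)^{|A|}\,h(\operatorname{lcm}(A))=\sum_{A\subseteq P_n}(-1)^{|A|}\prod_{a\in A}h(a)=\prod_{\substack{p\mid n\\ p\text{ prime}}}(1-h(p)).$$ The requirement that $n$ is non-prime can be removed if $L_n\setminus\{1,n\}$ is replaced by $L_n\setminus\{1\}$. Furthermore, if $n$ is not squarefree, then the sum on the left-hand side can be restricted to those $A$ with $\operatorname{lcm}(A)<n$.
   Context: $\mathbb{N}$ denotes the set of positive integers. A function $h:\mathbb{N}\to\mathbb{C}$ is multiplicative if $h(1)=1$ and $h(ab)=h(a)h(b)$ for any coprime $a,b\in\mathbb{N}$. $L_n$ denotes the set of positive divisors of $n$, $P_n$ the set of prime factors of $n$, and $\operatorname{lcm}(A)$ the least common multiple of the elements of $A$, with $\operatorname{lcm}(\emptyset)=1$. (For $h=\mathrm{id}_{\mathbb{N}}$, the right-hand side is the Dirichlet inverse of Euler's totient function.) *)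

theory Defs
  imports Complex_Main "HOL-Computational_Algebra.Primes" "HOL-Computational_Algebra.Squarefree"
begin

(* Arithmetic functions live on the positive integers; the value h 0 is unconstrained. *)
definition multiplicative_function :: "(nat \<Rightarrow> complex) \<Rightarrow> bool" where
  "multiplicative_function h \<longleftrightarrow>
     h 1 = 1 \<and> (\<forall>a b. a > 0 \<longrightarrow> b > 0 \<longrightarrow> coprime a b \<longrightarrow> h (a * b) = h a * h b)"

definition divisor_set :: "nat \<Rightarrow> nat set" where
  "divisor_set n = {d. d > 0 \<and> d dvd n}"

end

theory Submission
  imports Defs
begin

text \<open>
  The contribution of a set \<open>A\<close> of divisors depends only on the parity of its size and on its least
  common multiple. If \<open>A\<close> contains a composite number, let \<open>p\<close> be the least prime that
  divides a composite member of \<open>A\<close>. Inserting \<open>p\<close> into \<open>A\<close>, or removing it, flips the sign and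
  keeps the least common multiple, since that composite member already accounts for \<open>p\<close>; and it
  keeps the composite members, so that the choice of \<open>p\<close> is unaffected and the step undoes itself.
  Hence all these sets cancel in pairs and only the sets of primes are left
  (lemma \<open>sum_signed_Lcm_primes\<close>); on those the least common multiple is the product, and
  multiplicativity turns the sum into the expansion of an Euler product.

  The same cancellation serves all three sums. It runs inside any finite family that avoids 1 and
  is closed under prime factors, such as \<open>L\<^sub>n - {1}\<close> and, for non-prime \<open>n\<close>, \<open>L\<^sub>n - {1, n}\<close>; and it
  holds for every function of the least common multiple, so that restricting to sets of least
  common multiple less than \<open>n\<close> amounts to truncating \<open>h\<close>. When \<open>n\<close> is not squarefree, the
  truncation leaves the sets of primes alone, because a product of distinct prime factors
  of \<open>n\<close> is then a proper divisor of \<open>n\<close>.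
\<close>

definition composite_primes :: "nat set \<Rightarrow> nat set" where
  "composite_primes A = {p. prime p \<and> (\<exists>a\<in>A. \<not> prime a \<and> p dvd a)}"

definition toggle_prime :: "nat set \<Rightarrow> nat set" where
  "toggle_prime A =
     (let p = (LEAST p. p \<in> composite_primes A) in if p \<in> A then A - {p} else insert p A)"

lemma Lcm_insert_dvd_member:
  fixes B :: "nat set"
  assumes "a \<in> B" and "p dvd a"
  shows "Lcm (insert p B) = Lcm B"
  using assms by (metis Lcm_insert dvd_Lcm dvd_trans lcm_proj2_if_dvd normalize_Lcm)

text \<open>
  The last property is what makes the step an involution: a prime is all that enters or leaves
  \<open>A\<close>, and the choice of that prime looks at the non-prime members alone. A non-prime member
  other than 1 has to be present, for otherwise there is no prime to choose.
\<close>

lemma toggle_prime_properties: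
  assumes fin: "finite A" and a: "a \<in> A" "\<not> prime a" "a \<noteq> 1"
  shows "toggle_prime A \<subseteq> A \<union> composite_primes A"
    and "toggle_prime (toggle_prime A) = A"
    and "Lcm (toggle_prime A) = Lcm A"
    and "(-1) ^ card (toggle_prime A) = (- ((-1) ^ card A) :: 'a :: ring_1)"
    and "\<not> prime b \<Longrightarrow> b \<in> toggle_prime A \<longleftrightarrow> b \<in> A"
proof -
  define p where "p = (LEAST p. p \<in> composite_primes A)"
  have "\<exists>q. q \<in> composite_primes A"
    using a prime_factor_nat[of a] by (auto simp: composite_primes_def)
  then have p: "p \<in> composite_primes A"
    unfolding p_def by (rule LeastI_ex)
  then obtain c where c: "c \<in> A" "\<not> prime c" "p dvd c" and "prime p"
    by (auto simp: composite_primes_def)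
  then have "c \<noteq> p" by auto
  have tA: "toggle_prime A = (if p \<in> A then A - {p} else insert p A)"
    by (simp add: toggle_prime_def p_def)
  show "toggle_prime A \<subseteq> A \<union> composite_primes A"
    using p tA by auto
  have same: "b \<in> toggle_prime A \<longleftrightarrow> b \<in> A" if "\<not> prime b" for b
    using that \<open>prime p\<close> tA by auto
  show "\<not> prime b \<Longrightarrow> b \<in> toggle_prime A \<longleftrightarrow> b \<in> A"
    by (rule same)
  have "composite_primes (toggle_prime A) = composite_primes A"
    using same by (auto simp: composite_primes_def)
  then have "toggle_prime (toggle_prime A) =
      (if p \<in> toggle_prime A then toggle_prime A - {p} else insert p (toggle_prime A))"
    by (simp add: toggle_prime_def[of "toggle_prime A"] p_def)
  then show "toggle_prime (toggle_prime A) = A"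
    using tA by auto
  show "Lcm (toggle_prime A) = Lcm A"
  proof (cases "p \<in> A")
    case True
    have "Lcm (insert p (A - {p})) = Lcm (A - {p})"
      using c \<open>c \<noteq> p\<close> by (intro Lcm_insert_dvd_member[of c]) auto
    with True tA show ?thesis by (simp add: insert_absorb)
  next
    case False
    with tA show ?thesis by (simp add: Lcm_insert_dvd_member[OF c(1,3)] del: Lcm_insert)
  qed
  show "(-1) ^ card (toggle_prime A) = (- ((-1) ^ card A) :: 'a)"
  proof (cases "p \<in> A")
    case True
    then have "card A = Suc (card (A - {p}))"
      using fin by (metis card.remove)
    with True tA show ?thesis by (simp del: card_Diff_singleton card_Diff_insert)
  next
    case False
    with fin tA show ?thesis by simp
  qed
qed

text \<open>
  Closure under prime factors keeps the toggled sets inside \<open>S\<close>. The function \<open>g\<close> is kept general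
  so that a bound on the least common multiple can be absorbed into it.
\<close>

lemma sum_signed_Lcm_primes:
  fixes g :: "nat \<Rightarrow> 'a :: {idom, ring_char_0}"
  assumes fin: "finite S" and "1 \<notin> S"
    and closed: "\<And>p a. prime p \<Longrightarrow> p dvd a \<Longrightarrow> a \<in> S \<Longrightarrow> p \<in> S"
  shows "(\<Sum>A\<in>Pow S. (-1) ^ card A * g (Lcm A))
       = (\<Sum>A\<in>Pow {p\<in>S. prime p}. (-1) ^ card A * g (Lcm A))"
proof -
  define X where "X = {A. A \<subseteq> S \<and> (\<exists>a\<in>A. \<not> prime a)}"
  let ?f = "\<lambda>A. (-1) ^ card A * g (Lcm A)"
  have toggle: "toggle_prime A \<in> X" "toggle_prime (toggle_prime A) = A"
      "?f (toggle_prime A) = - ?f A" if "A \<in> X" for A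
  proof -
    obtain a where a: "a \<in> A" "\<not> prime a" "A \<subseteq> S"
      using \<open>A \<in> X\<close> by (auto simp: X_def)
    then have "finite A" "a \<noteq> 1"
      using fin finite_subset \<open>1 \<notin> S\<close> by auto
    note t = toggle_prime_properties[OF this(1) a(1,2) this(2)]
    have "composite_primes A \<subseteq> S"
      using closed \<open>A \<subseteq> S\<close> by (auto simp: composite_primes_def)
    with t(1) t(5)[of a] a show "toggle_prime A \<in> X"
      unfolding X_def by blast
    show "toggle_prime (toggle_prime A) = A" by (rule t(2))
    show "?f (toggle_prime A) = - ?f A" by (simp add: t(3,4))
  qed
  have "sum ?f X = (\<Sum>A\<in>X. - ?f A)"
    by (rule sum.reindex_bij_witness[of X toggle_prime toggle_prime]) (simp_all add: toggle)
  then have "sum ?f X = - sum ?f X"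
    by (simp add: sum_negf)
  then have "2 * sum ?f X = 0"
    by (metis add.right_inverse mult_2)
  then have "sum ?f X = 0"
    by simp
  moreover have "Pow S - Pow {p\<in>S. prime p} = X"
    by (auto simp: X_def)
  ultimately show ?thesis
    using sum.subset_diff[of "Pow {p\<in>S. prime p}" "Pow S" ?f] fin by auto
qed

lemma coprime_prod_primes:
  fixes p :: nat
  assumes "prime p" and "p \<notin> A" and "\<And>q. q \<in> A \<Longrightarrow> prime q"
  shows "coprime p (\<Prod>A)"
  by (rule prod_coprime_right, rule primes_coprime) (use assms in auto)

lemma Lcm_primes:
  fixes A :: "nat set"
  assumes "finite A" and "\<And>p. p \<in> A \<Longrightarrow> prime p"
  shows "Lcm A = \<Prod>A"
  using assms
proof (induction A)
  case (insert p A)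
  have "coprime p (\<Prod>A)"
    using insert.hyps insert.prems by (intro coprime_prod_primes) auto
  with insert show ?case by (simp add: lcm_coprime)
qed simp

lemma multiplicative_function_prod_primes:
  assumes h: "multiplicative_function h" and "finite A" and "\<And>p. p \<in> A \<Longrightarrow> prime p"
  shows "h (\<Prod>A) = (\<Prod>p\<in>A. h p)"
  using assms(2,3)
proof (induction A)
  case empty
  with h show ?case by (simp add: multiplicative_function_def)
next
  case (insert p A)
  have "coprime p (\<Prod>A)"
    using insert.hyps insert.prems by (intro coprime_prod_primes) auto
  moreover have "p > 0" "\<Prod>A > 0"
    using insert.prems by (auto intro!: prod_pos intro: prime_gt_0_nat)
  ultimately have "h (p * \<Prod>A) = h p * h (\<Prod>A)"
    using h by (simp add: multiplicative_function_def)
  with insert show ?case by simp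
qed

text \<open>
  The least common multiple of distinct primes is their product, hence squarefree: it divides \<open>n\<close>
  but cannot be \<open>n\<close>.
\<close>

lemma Lcm_prime_factors_less:
  fixes n :: nat
  assumes "n > 0" and "\<not> squarefree n" and A: "A \<subseteq> prime_factors n"
  shows "Lcm A < n"
proof -
  have "finite A" and primes: "\<And>p. p \<in> A \<Longrightarrow> prime p"
    using A finite_subset by auto
  then have "squarefree (\<Prod>A)"
    by (intro squarefree_prod_coprime) (auto intro: primes_coprime squarefree_prime)
  then have "Lcm A \<noteq> n"
    using assms(2) Lcm_primes[OF \<open>finite A\<close> primes] by auto
  moreover have "Lcm A dvd n"
    using A by (intro Lcm_least) auto
  ultimately show ?thesis
    using \<open>n > 0\<close> by (simp add: dvd_imp_le le_neq_implies_less)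
qed

theorem mainTheorem9:
  fixes h :: "nat \<Rightarrow> complex" and n :: nat
  assumes "multiplicative_function h" and "n \<ge> 1"
  shows
    "(\<not> prime n \<longrightarrow>
        (\<Sum>A\<in>Pow (divisor_set n - {1, n}). (-1) ^ card A * h (Lcm A))
          = (\<Sum>A\<in>Pow (prime_factors n). (-1) ^ card A * (\<Prod>a\<in>A. h a)) \<and>
        (\<Sum>A\<in>Pow (prime_factors n). (-1) ^ card A * (\<Prod>a\<in>A. h a))
          = (\<Prod>p | prime p \<and> p dvd n. 1 - h p)) \<and>
     ((\<Sum>A\<in>Pow (divisor_set n - {1}). (-1) ^ card A * h (Lcm A))
          = (\<Sum>A\<in>Pow (prime_factors n). (-1) ^ card A * (\<Prod>a\<in>A. h a)) \<and>
        (\<Sum>A\<in>Pow (prime_factors n). (-1) ^ card A * (\<Prod>a\<in>A. h a))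
          = (\<Prod>p | prime p \<and> p dvd n. 1 - h p)) \<and>
     (\<not> squarefree n \<longrightarrow>
        (\<Sum>A | A \<subseteq> divisor_set n - {1, n} \<and> Lcm A < n. (-1) ^ card A * h (Lcm A))
          = (\<Sum>A\<in>Pow (prime_factors n). (-1) ^ card A * (\<Prod>a\<in>A. h a)) \<and>
        (\<Sum>A\<in>Pow (prime_factors n). (-1) ^ card A * (\<Prod>a\<in>A. h a))
          = (\<Prod>p | prime p \<and> p dvd n. 1 - h p))"
proof -
  let ?rhs = "\<Sum>A\<in>Pow (prime_factors n). (-1) ^ card A * (\<Prod>a\<in>A. h a)"
  let ?f = "\<lambda>A. (-1) ^ card A * h (Lcm A)"
  have fin: "finite (divisor_set n)"
    using \<open>n \<ge> 1\<close> by (simp add: divisor_set_def)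
  have h_Lcm: "h (Lcm A) = (\<Prod>a\<in>A. h a)" if "A \<subseteq> prime_factors n" for A
  proof -
    have "finite A" "\<And>p. p \<in> A \<Longrightarrow> prime p"
      using that finite_subset by auto
    then show ?thesis
      using assms(1) by (simp add: Lcm_primes multiplicative_function_prod_primes)
  qed
  have reduce: "(\<Sum>A\<in>Pow S. (-1) ^ card A * g (Lcm A)) = ?rhs"
    if S: "prime_factors n \<subseteq> S" "S \<subseteq> divisor_set n - {1}"
      and g: "\<And>A. A \<subseteq> prime_factors n \<Longrightarrow> g (Lcm A) = h (Lcm A)"
    for S and g :: "nat \<Rightarrow> complex"
  proof -
    have primes: "{p\<in>S. prime p} = prime_factors n"
      using S \<open>n \<ge> 1\<close> by (auto simp: divisor_set_def prime_factors_dvd)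
    have "p \<in> S" if "prime p" "p dvd a" "a \<in> S" for p a
    proof -
      have "p dvd n"
        using that S by (auto simp: divisor_set_def intro: dvd_trans)
      then show ?thesis
        using \<open>prime p\<close> S(1) \<open>n \<ge> 1\<close> by (auto simp: prime_factors_dvd)
    qed
    then have "(\<Sum>A\<in>Pow S. (-1) ^ card A * g (Lcm A))
        = (\<Sum>A\<in>Pow (prime_factors n). (-1) ^ card A * g (Lcm A))"
      using sum_signed_Lcm_primes[of S g] S fin finite_subset[of S "divisor_set n"] primes
      by auto
    also have "\<dots> = ?rhs"
      by (intro sum.cong) (auto simp: g h_Lcm)
    finally show ?thesis .
  qed
  \<comment> \<open>Leaving out \<open>n\<close> loses a prime factor only if \<open>n\<close> itself is prime.\<close>
  have proper: "prime_factors n \<subseteq> divisor_set n - {1, n}" if "\<not> prime n"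
    using that \<open>n \<ge> 1\<close> by (auto simp: divisor_set_def prime_factors_dvd intro: prime_gt_0_nat)
  have nonprime: "sum ?f (Pow (divisor_set n - {1, n})) = ?rhs" if "\<not> prime n"
    using proper[OF that] by (intro reduce) auto
  have all: "sum ?f (Pow (divisor_set n - {1})) = ?rhs"
    using \<open>n \<ge> 1\<close> by (intro reduce) (auto simp: divisor_set_def prime_factors_dvd intro: prime_gt_0_nat)
  have restricted: "(\<Sum>A | A \<subseteq> divisor_set n - {1, n} \<and> Lcm A < n. ?f A) = ?rhs"
    if "\<not> squarefree n"
  proof -
    let ?g = "\<lambda>d. if d < n then h d else 0"
    have "\<not> prime n"
      using that squarefree_prime by blast
    have "(\<Sum>A | A \<subseteq> divisor_set n - {1, n} \<and> Lcm A < n. ?f A)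
        = (\<Sum>A\<in>Pow (divisor_set n - {1, n}). (-1) ^ card A * ?g (Lcm A))"
      using fin by (intro sum.mono_neutral_cong_left) auto
    also have "\<dots> = ?rhs"
      using proper[OF \<open>\<not> prime n\<close>] Lcm_prime_factors_less[OF _ that] \<open>n \<ge> 1\<close>
      by (intro reduce) auto
    finally show ?thesis .
  qed
  have "{p. prime p \<and> p dvd n} = prime_factors n"
    using \<open>n \<ge> 1\<close> by (auto simp: prime_factors_dvd)
  then have "?rhs = (\<Prod>p | prime p \<and> p dvd n. 1 - h p)"
    using prod_diff_conv_sum[of "prime_factors n" "\<lambda>_. 1" h] by simp
  then show ?thesis
    using nonprime all restricted by blast
qed

end
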